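(* The system $$A^2u+C_uAu+k(u-v)=0,\qquad A^2v+C_vAv-k(u-v)=0,$$ with $C_u=\beta+\varrho\|u\|_1^2$, $C_v=\beta+\varrho\|v\|_1^2$, admits nontrivial unimodal solutions if and only if the set $\mathbb{E}$ is nonempty. More precisely, for every $n\in\mathbb{N}$, one of the following disjoint situations occurs. (1) If $n\in\mathbb{E}_1$, there are exactly 2 nontrivial unimodal solutions involving $e_n$, namely $(u,v)=(\alpha_{n,1}^+e_n,\alpha_{n,1}^+e_n)$ and $(\alpha_{n,1}^-e_n,\alpha_{n,1}^-e_n)$. (2) If $n\in\mathbb{E}_2$, there are exactly 4 nontrivial unimodal solutions involving $e_n$, namely $(\alpha_{n,1}^+e_n,\alpha_{n,1}^+e_n)$, $(\alpha_{n,1}^-e_n,\alpha_{n,1}^-e_n)$, $(\alpha_{n,2}^+e_n,\alpha_{n,2}^-e_n)$, $(\alpha_{n,2}^-e_n,\alpha_{n,2}^+e_n)$. (3) If $n\in\mathbb{E}_3$, there are exactly 8 nontrivial unimodal solutions involving $e_n$, namely $(\alpha_{n,1}^+e_n,\alpha_{n,1}^+e_n)$, $(\alpha_{n,1}^-e_n,\alpha_{n,1}^-e_n)$, $(\alpha_{n,2}^+e_n,\alpha_{n,2}^-e_n)$, $(\alpha_{n,2}^-e_n,\alpha_{n,2}^+e_n)$, $(\alpha_{n,3}^+e_n,\alpha_{n,4}^-e_n)$, $(\alpha_{n,3}^-e_n,\alpha_{n,4}^+e_n)$, $(\alpha_{n,4}^+e_n,\alpha_{n,3}^-e_n)$, $(\alpha_{n,4}^-e_n,\alpha_{n,3}^+e_n)$.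 (4) If $n\notin\mathbb{E}$, all the solutions of the form $(\alpha e_n,\gamma e_n)$, $\alpha,\gamma\in\mathbb{R}$, are trivial. In summary, the system admits $2|\mathbb{E}_1|+4|\mathbb{E}_2|+8|\mathbb{E}_3|$ nontrivial unimodal solutions.
   Context: Let $H$ be a separable real Hilbert space with inner product $\langle\cdot,\cdot\rangle$ and norm $\|\cdot\|$, and let $A:D(A)\subset H\to H$ be a strictly positive selfadjoint linear operator whose domain is densely and compactly embedded in $H$. For $r\ge0$ set $H^r=D(A^{r/2})$, $\langle u,v\rangle_r=\langle A^{r/2}u,A^{r/2}v\rangle$, $\|u\|_r=\|A^{r/2}u\|$. All eigenvalues of $A$ are assumed simple; they form the increasing sequence $0<\lambda_1<\lambda_2<\cdots\to\infty$ ($n\in\mathbb{N}=\{1,2,3,\dots\}$), and the corresponding normalized eigenvectors $e_n$ form a complete orthonormal basis of $H$. Fix $\beta\in\mathbb{R}$ and $\varrho,k>0$. A (weak) solution of the system is a couple $(u,v)\in H^2\times H^2$ such that $$\langle u,\phi\rangle_2+C_u\langle u,\phi\rangle_1+k\langle u-v,\phi\rangle=0,\qquad \langle v,\psi\rangle_2+C_v\langle v,\psi\rangle_1-k\langle u-v,\psi\rangle=0$$ for every $(\phi,\psi)\in H^2\times H^2$. The trivial solution is $u=v=0$. A nontrivial unimodal solution involving $e_n$ is a solution of the form $(u,v)=(\alpha_ne_n,\gamma_ne_n)$ with $\alpha_n,\gamma_n\in\mathbb{R}\setminus\{0\}$. Put $\mu_n=\frac{2k}{\lambda_n}+\lambda_n$,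 $\nu_n=\frac{3k}{\lambda_n}+\lambda_n$, and $$\mathbb{E}=\{n:\lambda_n<-\beta\},\quad \mathbb{E}_1=\{n:\lambda_n<-\beta\le\mu_n\},\quad \mathbb{E}_2=\{n:\mu_n<-\beta\le\nu_n\},\quad \mathbb{E}_3=\{n:\nu_n<-\beta\}.$$ Whenever real, set $$\alpha_{n,1}^\pm=\pm\sqrt{\frac{-\beta-\lambda_n}{\varrho\lambda_n}},\qquad \alpha_{n,2}^\pm=\pm\sqrt{\frac{-\beta-\mu_n}{\varrho\lambda_n}},$$ $$\alpha_{n,3}^\pm=\pm\sqrt{\frac{-\beta+\mu_n-\nu_n-\lambda_n+\sqrt{(\beta+\lambda_n+\mu_n-\nu_n)(\beta+\nu_n)}}{2\varrho\lambda_n}},$$ $$\alpha_{n,4}^\pm=\pm\sqrt{\frac{-\beta+\mu_n-\nu_n-\lambda_n-\sqrt{(\beta+\lambda_n+\mu_n-\nu_n)(\beta+\nu_n)}}{2\varrho\lambda_n}}.$$ $|\mathbb{S}|$ denotes the cardinality of a set $\mathbb{S}$. *)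

theory Defs
  imports "HOL-Analysis.Analysis"
begin

text \<open>
  Unbounded operators are represented by a domain \<open>D\<close> together with a total function \<open>A\<close>
  whose values outside \<open>D\<close> are irrelevant.
\<close>

definition linear_operator :: "'h::real_inner set \<Rightarrow> ('h \<Rightarrow> 'h) \<Rightarrow> bool" where
  "linear_operator D A \<longleftrightarrow> subspace D \<and>
     (\<forall>x\<in>D. \<forall>y\<in>D. A (x + y) = A x + A y) \<and> (\<forall>c. \<forall>x\<in>D. A (c *\<^sub>R x) = c *\<^sub>R A x)"

definition adjoint_domain :: "'h::real_inner set \<Rightarrow> ('h \<Rightarrow> 'h) \<Rightarrow> 'h set" where
  "adjoint_domain D A = {y. \<exists>z. \<forall>x\<in>D. A x \<bullet> y = x \<bullet> z}"

definition selfadjoint_operator :: "'h::real_inner set \<Rightarrow> ('h \<Rightarrow> 'h) \<Rightarrow> bool" where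
  "selfadjoint_operator D A \<longleftrightarrow> linear_operator D A \<and> closure D = UNIV \<and>
     (\<forall>x\<in>D. \<forall>y\<in>D. A x \<bullet> y = x \<bullet> A y) \<and> adjoint_domain D A = D"

definition strictly_positive_operator :: "'h::real_inner set \<Rightarrow> ('h \<Rightarrow> 'h) \<Rightarrow> bool" where
  "strictly_positive_operator D A \<longleftrightarrow> (\<forall>x\<in>D. x \<noteq> 0 \<longrightarrow> 0 < A x \<bullet> x)"

text \<open>The domain carries the graph norm; its unit ball must be relatively compact in the space.\<close>

definition compactly_embedded_domain :: "'h::real_inner set \<Rightarrow> ('h \<Rightarrow> 'h) \<Rightarrow> bool" where
  "compactly_embedded_domain D A \<longleftrightarrow>
     compact (closure {x\<in>D. sqrt ((norm x)\<^sup>2 + (norm (A x))\<^sup>2) \<le> 1})"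

definition eigenspace :: "'h::real_inner set \<Rightarrow> ('h \<Rightarrow> 'h) \<Rightarrow> real \<Rightarrow> 'h set" where
  "eigenspace D A c = {x\<in>D. A x = c *\<^sub>R x}"

definition eigenvalues :: "'h::real_inner set \<Rightarrow> ('h \<Rightarrow> 'h) \<Rightarrow> real set" where
  "eigenvalues D A = {c. \<exists>x\<in>eigenspace D A c. x \<noteq> 0}"

text \<open>
  The class \<^class>\<open>polish_space\<close> supplies completeness and separability of the Hilbert space.
  Sequences are indexed by the positive integers; \<open>lam 0\<close> and \<open>e 0\<close> are irrelevant.
\<close>

locale simple_spectrum_operator =
  fixes D :: "'h::{real_inner, polish_space} set" and A :: "'h \<Rightarrow> 'h"
    and lam :: "nat \<Rightarrow> real" and e :: "nat \<Rightarrow> 'h"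
  assumes selfadjoint: "selfadjoint_operator D A"
    and strictly_positive: "strictly_positive_operator D A"
    and compactly_embedded: "compactly_embedded_domain D A"
    and eigenvalues_eq: "eigenvalues D A = lam ` {1..}"
    and simple_eigenvalues: "\<And>c. c \<in> eigenvalues D A \<Longrightarrow> dim (eigenspace D A c) = 1"
    and lam_pos: "\<And>n. n \<ge> 1 \<Longrightarrow> 0 < lam n"
    and lam_strict_mono: "strict_mono_on {1..} lam"
    and lam_at_top: "filterlim lam at_top sequentially"
    and e_eigenvector: "\<And>n. n \<ge> 1 \<Longrightarrow> e n \<in> eigenspace D A (lam n)"
    and e_orthonormal: "\<And>m n. m \<ge> 1 \<Longrightarrow> n \<ge> 1 \<Longrightarrow> e m \<bullet> e n = (if m = n then 1 else 0)"
    and e_complete: "closure (span (e ` {1..})) = UNIV"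

text \<open>
  Fractional powers \<open>A\<^sup>s\<close>, \<open>s \<ge> 0\<close>, through the spectral decomposition of \<open>A\<close>. The lemmas
  \<open>pow_domain_one\<close> and \<open>op_power_one\<close> below confirm that \<open>s = 1\<close> gives back \<open>A\<close> with its domain.
\<close>

definition pow_domain :: "(nat \<Rightarrow> real) \<Rightarrow> (nat \<Rightarrow> 'h::real_inner) \<Rightarrow> real \<Rightarrow> 'h set" where
  "pow_domain lam e s = {u. (\<lambda>n. (lam n powr s * (u \<bullet> e n))\<^sup>2) summable_on {1..}}"

definition op_power :: "(nat \<Rightarrow> real) \<Rightarrow> (nat \<Rightarrow> 'h::real_inner) \<Rightarrow> real \<Rightarrow> 'h \<Rightarrow> 'h" where
  "op_power lam e s u = (\<Sum>\<^sub>\<infinity>n\<in>{1..}. (lam n powr s * (u \<bullet> e n)) *\<^sub>R e n)"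

definition Hspace :: "(nat \<Rightarrow> real) \<Rightarrow> (nat \<Rightarrow> 'h::real_inner) \<Rightarrow> real \<Rightarrow> 'h set" where
  "Hspace lam e r = pow_domain lam e (r / 2)"

definition Hinner :: "(nat \<Rightarrow> real) \<Rightarrow> (nat \<Rightarrow> 'h::real_inner) \<Rightarrow> real \<Rightarrow> 'h \<Rightarrow> 'h \<Rightarrow> real" where
  "Hinner lam e r u v = op_power lam e (r / 2) u \<bullet> op_power lam e (r / 2) v"

definition Hnorm :: "(nat \<Rightarrow> real) \<Rightarrow> (nat \<Rightarrow> 'h::real_inner) \<Rightarrow> real \<Rightarrow> 'h \<Rightarrow> real" where
  "Hnorm lam e r u = norm (op_power lam e (r / 2) u)"

context simple_spectrum_operator
begin

lemma norm_sum_e: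
  assumes "finite F" "F \<subseteq> {1..}"
  shows "(norm (\<Sum>n\<in>F. c n *\<^sub>R e n))\<^sup>2 = (\<Sum>n\<in>F. (c n)\<^sup>2)"
proof -
  have "(norm (\<Sum>n\<in>F. c n *\<^sub>R e n))\<^sup>2 = (\<Sum>n\<in>F. \<Sum>m\<in>F. c n * (c m * (e n \<bullet> e m)))"
    unfolding power2_norm_eq_inner inner_sum_left unfolding inner_sum_right by (simp add: mult.left_commute)
  also have "\<dots> = (\<Sum>n\<in>F. \<Sum>m\<in>F. if n = m then (c n)\<^sup>2 else 0)"
    using assms(2) by (intro sum.cong) (auto simp: e_orthonormal power2_eq_square subset_iff)
  also have "\<dots> = (\<Sum>n\<in>F. (c n)\<^sup>2)"
    using assms(1) by simp
  finally show ?thesis .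
qed

lemma bessel: "(\<lambda>n. (x \<bullet> e n)\<^sup>2) summable_on {1..}"
proof (rule nonneg_bdd_above_summable_on)
  have "(\<Sum>n\<in>F. (x \<bullet> e n)\<^sup>2) \<le> (norm x)\<^sup>2" if F: "finite F" "F \<subseteq> {1..}" for F
  proof -
    let ?y = "\<Sum>n\<in>F. (x \<bullet> e n) *\<^sub>R e n"
    have "x \<bullet> ?y = (\<Sum>n\<in>F. (x \<bullet> e n)\<^sup>2)"
      by (simp add: inner_sum_right power2_eq_square)
    moreover have "?y \<bullet> ?y = (\<Sum>n\<in>F. (x \<bullet> e n)\<^sup>2)"
      using norm_sum_e[OF F, of "\<lambda>n. x \<bullet> e n"] by (simp add: power2_norm_eq_inner)
    moreover have "0 \<le> (x - ?y) \<bullet> (x - ?y)" by simp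
    ultimately show ?thesis
      by (simp add: inner_diff_left inner_diff_right inner_commute power2_norm_eq_inner)
  qed
  then show "bdd_above (sum (\<lambda>n. (x \<bullet> e n)\<^sup>2) ` {F. F \<subseteq> {1..} \<and> finite F})"
    by (auto intro!: bdd_aboveI2)
qed auto

lemma summable_e:
  assumes "(\<lambda>n. (c n)\<^sup>2) summable_on {1..}"
  shows "(\<lambda>n. c n *\<^sub>R e n) summable_on {1..}"
proof -
  let ?f = "\<lambda>n. c n *\<^sub>R e n"
  obtain S where S: "((\<lambda>n. (c n)\<^sup>2) has_sum S) {1..}"
    using assms by (auto simp: summable_on_def)
  have "\<exists>P. eventually P (finite_subsets_at_top {1..}) \<and>
          (\<forall>F G. P F \<and> P G \<longrightarrow> dist (sum ?f F) (sum ?f G) < d)" if d: "d > 0" for d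
  proof -
    obtain F0 where F0: "finite F0" "F0 \<subseteq> {1..}" "dist (\<Sum>n\<in>F0. (c n)\<^sup>2) S \<le> (d/3)\<^sup>2"
      using has_sum_finite_approximation[OF S, of "(d/3)\<^sup>2"] d by auto
    define P where "P F \<longleftrightarrow> finite F \<and> F0 \<subseteq> F \<and> F \<subseteq> {1..}" for F
    have near: "dist (sum ?f F) (sum ?f F0) \<le> d/3" if F: "P F" for F
    proof -
      have "(dist (sum ?f F) (sum ?f F0))\<^sup>2 = (norm (sum ?f (F - F0)))\<^sup>2"
        using F F0(1) by (simp add: P_def dist_norm sum_diff)
      also have "\<dots> = (\<Sum>n\<in>F. (c n)\<^sup>2) - (\<Sum>n\<in>F0. (c n)\<^sup>2)"
        using F F0(1) by (subst norm_sum_e) (auto simp: P_def sum_diff)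
      also have "\<dots> \<le> S - (\<Sum>n\<in>F0. (c n)\<^sup>2)"
        using F finite_sum_le_has_sum[OF S, of F] by (simp add: P_def)
      also have "\<dots> \<le> (d/3)\<^sup>2"
        using F0(3) by (simp add: dist_real_def)
      finally show ?thesis
        by (rule power2_le_imp_le) (use d in simp)
    qed
    have "dist (sum ?f F) (sum ?f G) < d" if "P F" "P G" for F G
      using near[OF that(1)] near[OF that(2)] d
        dist_triangle2[of "sum ?f F" "sum ?f G" "sum ?f F0"] by linarith
    moreover have "eventually P (finite_subsets_at_top {1..})"
      unfolding eventually_finite_subsets_at_top P_def using F0 by blast
    ultimately show ?thesis by blast
  qed
  then have "cauchy_filter (filtermap (sum ?f) (finite_subsets_at_top {1..}))"
    by (simp add: cauchy_filter_metric_filtermap)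
  moreover have "complete (UNIV :: 'h set)"
    by (meson Cauchy_convergent UNIV_I complete_def convergent_def)
  ultimately obtain w where "(sum ?f \<longlongrightarrow> w) (finite_subsets_at_top {1..})"
    using complete_uniform[where S = UNIV] by (force simp: filterlim_def)
  then show ?thesis
    using summable_on_def has_sum_def by blast
qed

lemma expansion: "((\<lambda>n. (x \<bullet> e n) *\<^sub>R e n) has_sum x) {1..}"
proof -
  obtain w where w: "((\<lambda>n. (x \<bullet> e n) *\<^sub>R e n) has_sum w) {1..}"
    using summable_e[OF bessel] by (auto simp: summable_on_def)
  have "(x - w) \<bullet> e m = 0" if m: "m \<ge> 1" for m
  proof -
    have "((\<lambda>n. ((x \<bullet> e n) *\<^sub>R e n) \<bullet> e m) has_sum (w \<bullet> e m)) {1..}"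
      using has_sum_bounded_linear[OF bounded_linear_inner_left w] by (simp add: o_def)
    moreover have "((\<lambda>n. ((x \<bullet> e n) *\<^sub>R e n) \<bullet> e m) has_sum (x \<bullet> e m)) {1..}"
    proof (rule has_sum_finite_neutralI[of "{m}"])
      qed (use m in \<open>auto simp: e_orthonormal\<close>)
    ultimately have "w \<bullet> e m = x \<bullet> e m"
      by (rule has_sum_unique)
    then show ?thesis by (simp add: inner_diff_left)
  qed
  then have "span (e ` {1..}) \<subseteq> {y. (x - w) \<bullet> y = 0}"
    by (intro span_minimal) (auto simp: subspace_hyperplane)
  then have "closure (span (e ` {1..})) \<subseteq> {y. (x - w) \<bullet> y = 0}"
    by (intro closure_minimal closed_hyperplane)
  then have "x - w \<in> {y. (x - w) \<bullet> y = 0}"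
    unfolding e_complete by blast
  then show ?thesis using w by simp
qed

lemma A_inner_e: "x \<in> D \<Longrightarrow> n \<ge> 1 \<Longrightarrow> A x \<bullet> e n = lam n * (x \<bullet> e n)"
  using selfadjoint e_eigenvector[of n]
  by (auto simp: selfadjoint_operator_def eigenspace_def)

lemma abs_lam: "Suc 0 \<le> n \<Longrightarrow> \<bar>lam n\<bar> = lam n"
  using lam_pos[of n] by simp

lemma op_power_one:
  assumes "u \<in> D"
  shows "op_power lam e 1 u = A u"
proof -
  have "op_power lam e 1 u = (\<Sum>\<^sub>\<infinity>n\<in>{1..}. (A u \<bullet> e n) *\<^sub>R e n)"
    unfolding op_power_def using assms by (intro infsum_cong) (simp add: A_inner_e abs_lam)
  then show ?thesis using infsumI[OF expansion] by simp
qed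

lemma pow_domain_one: "pow_domain lam e 1 = D"
proof (intro equalityI subsetI)
  fix u assume "u \<in> D"
  then have "(\<lambda>n. (lam n powr 1 * (u \<bullet> e n))\<^sup>2) summable_on {1..} \<longleftrightarrow>
      (\<lambda>n. (A u \<bullet> e n)\<^sup>2) summable_on {1..}"
    by (intro summable_on_cong) (simp add: A_inner_e abs_lam)
  then show "u \<in> pow_domain lam e 1" using bessel[of "A u"] by (simp add: pow_domain_def)
next
  fix u assume "u \<in> pow_domain lam e 1"
  moreover have "(\<lambda>n. (lam n powr 1 * (u \<bullet> e n))\<^sup>2) summable_on {1..} \<longleftrightarrow>
      (\<lambda>n. (lam n * (u \<bullet> e n))\<^sup>2) summable_on {1..}"
    by (intro summable_on_cong) (simp add: abs_lam)
  ultimately have "(\<lambda>n. (lam n * (u \<bullet> e n)) *\<^sub>R e n) summable_on {1..}"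
    by (intro summable_e) (simp add: pow_domain_def)
  then obtain z where z: "((\<lambda>n. (lam n * (u \<bullet> e n)) *\<^sub>R e n) has_sum z) {1..}"
    by (auto simp: summable_on_def)
  have "A x \<bullet> u = x \<bullet> z" if x: "x \<in> D" for x
  proof -
    have "((\<lambda>n. A x \<bullet> ((u \<bullet> e n) *\<^sub>R e n)) has_sum (A x \<bullet> u)) {1..}"
      using has_sum_bounded_linear[OF bounded_linear_inner_right expansion] by (simp add: o_def)
    moreover have "((\<lambda>n. x \<bullet> ((lam n * (u \<bullet> e n)) *\<^sub>R e n)) has_sum (x \<bullet> z)) {1..}"
      using has_sum_bounded_linear[OF bounded_linear_inner_right z] by (simp add: o_def)
    moreover have "((\<lambda>n. x \<bullet> ((lam n * (u \<bullet> e n)) *\<^sub>R e n)) has_sum (x \<bullet> z)) {1..} \<longleftrightarrow>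
       ((\<lambda>n. A x \<bullet> ((u \<bullet> e n) *\<^sub>R e n)) has_sum (x \<bullet> z)) {1..}"
      by (intro has_sum_cong) (auto simp: A_inner_e x)
    ultimately show ?thesis using has_sum_unique by blast
  qed
  then have "u \<in> adjoint_domain D A" by (auto simp: adjoint_domain_def)
  then show "u \<in> D" using selfadjoint by (simp add: selfadjoint_operator_def)
qed

end

text \<open>The coefficient \<open>C\<^sub>u = \<beta> + \<rho> \<parallel>u\<parallel>\<^sub>1\<^sup>2\<close>.\<close>

definition stiffness :: "(nat \<Rightarrow> real) \<Rightarrow> (nat \<Rightarrow> 'h::real_inner) \<Rightarrow> real \<Rightarrow> real \<Rightarrow> 'h \<Rightarrow> real" where
  "stiffness lam e \<beta> \<rho> u = \<beta> + \<rho> * (Hnorm lam e 1 u)\<^sup>2"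

definition weak_solution ::
  "(nat \<Rightarrow> real) \<Rightarrow> (nat \<Rightarrow> 'h::real_inner) \<Rightarrow> real \<Rightarrow> real \<Rightarrow> real \<Rightarrow> 'h \<times> 'h \<Rightarrow> bool" where
  "weak_solution lam e \<beta> \<rho> k = (\<lambda>(u, v).
     u \<in> Hspace lam e 2 \<and> v \<in> Hspace lam e 2 \<and>
     (\<forall>\<phi>\<in>Hspace lam e 2. \<forall>\<psi>\<in>Hspace lam e 2.
        Hinner lam e 2 u \<phi> + stiffness lam e \<beta> \<rho> u * Hinner lam e 1 u \<phi> + k * ((u - v) \<bullet> \<phi>) = 0 \<and>
        Hinner lam e 2 v \<psi> + stiffness lam e \<beta> \<rho> v * Hinner lam e 1 v \<psi> - k * ((u - v) \<bullet> \<psi>) = 0))"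

definition unimodal_solutions ::
  "(nat \<Rightarrow> real) \<Rightarrow> (nat \<Rightarrow> 'h::real_inner) \<Rightarrow> real \<Rightarrow> real \<Rightarrow> real \<Rightarrow> nat \<Rightarrow> ('h \<times> 'h) set" where
  "unimodal_solutions lam e \<beta> \<rho> k n =
     {w. weak_solution lam e \<beta> \<rho> k w \<and>
         (\<exists>\<alpha> \<gamma>. \<alpha> \<noteq> 0 \<and> \<gamma> \<noteq> 0 \<and> w = (\<alpha> *\<^sub>R e n, \<gamma> *\<^sub>R e n))}"

definition mu :: "(nat \<Rightarrow> real) \<Rightarrow> real \<Rightarrow> nat \<Rightarrow> real" where
  "mu lam k n = 2 * k / lam n + lam n"

definition nu :: "(nat \<Rightarrow> real) \<Rightarrow> real \<Rightarrow> nat \<Rightarrow> real" where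
  "nu lam k n = 3 * k / lam n + lam n"

definition EE :: "(nat \<Rightarrow> real) \<Rightarrow> real \<Rightarrow> nat set" where
  "EE lam \<beta> = {n. n \<ge> 1 \<and> lam n < - \<beta>}"

definition EE1 :: "(nat \<Rightarrow> real) \<Rightarrow> real \<Rightarrow> real \<Rightarrow> nat set" where
  "EE1 lam \<beta> k = {n. n \<ge> 1 \<and> lam n < - \<beta> \<and> - \<beta> \<le> mu lam k n}"

definition EE2 :: "(nat \<Rightarrow> real) \<Rightarrow> real \<Rightarrow> real \<Rightarrow> nat set" where
  "EE2 lam \<beta> k = {n. n \<ge> 1 \<and> mu lam k n < - \<beta> \<and> - \<beta> \<le> nu lam k n}"

definition EE3 :: "(nat \<Rightarrow> real) \<Rightarrow> real \<Rightarrow> real \<Rightarrow> nat set" where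
  "EE3 lam \<beta> k = {n. n \<ge> 1 \<and> nu lam k n < - \<beta>}"

text \<open>
  The radicands of the amplitudes. They are named separately because \<^const>\<open>sqrt\<close> is total on the
  reals (\<open>sqrt (- x) = - sqrt x\<close>): an amplitude is real exactly when its radicand is nonnegative,
  which for \<open>rad3\<close> and \<open>rad4\<close> presupposes that the inner radicand \<open>disc\<close> is nonnegative.
\<close>

definition rad1 :: "(nat \<Rightarrow> real) \<Rightarrow> real \<Rightarrow> real \<Rightarrow> nat \<Rightarrow> real" where
  "rad1 lam \<beta> \<rho> n = (- \<beta> - lam n) / (\<rho> * lam n)"

definition rad2 :: "(nat \<Rightarrow> real) \<Rightarrow> real \<Rightarrow> real \<Rightarrow> real \<Rightarrow> nat \<Rightarrow> real" where
  "rad2 lam \<beta> \<rho> k n = (- \<beta> - mu lam k n) / (\<rho> * lam n)"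

definition disc :: "(nat \<Rightarrow> real) \<Rightarrow> real \<Rightarrow> real \<Rightarrow> nat \<Rightarrow> real" where
  "disc lam \<beta> k n = (\<beta> + lam n + mu lam k n - nu lam k n) * (\<beta> + nu lam k n)"

definition rad3 :: "(nat \<Rightarrow> real) \<Rightarrow> real \<Rightarrow> real \<Rightarrow> real \<Rightarrow> nat \<Rightarrow> real" where
  "rad3 lam \<beta> \<rho> k n =
     (- \<beta> + mu lam k n - nu lam k n - lam n + sqrt (disc lam \<beta> k n)) / (2 * \<rho> * lam n)"

definition rad4 :: "(nat \<Rightarrow> real) \<Rightarrow> real \<Rightarrow> real \<Rightarrow> real \<Rightarrow> nat \<Rightarrow> real" where
  "rad4 lam \<beta> \<rho> k n =
     (- \<beta> + mu lam k n - nu lam k n - lam n - sqrt (disc lam \<beta> k n)) / (2 * \<rho> * lam n)"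

text \<open>The amplitudes \<open>\<alpha>\<^sub>n\<^sub>,\<^sub>i\<^sup>+\<close>; the amplitude \<open>\<alpha>\<^sub>n\<^sub>,\<^sub>i\<^sup>-\<close> is \<open>- \<alpha>\<^sub>n\<^sub>,\<^sub>i\<^sup>+\<close>.\<close>

definition alpha1 :: "(nat \<Rightarrow> real) \<Rightarrow> real \<Rightarrow> real \<Rightarrow> nat \<Rightarrow> real" where
  "alpha1 lam \<beta> \<rho> n = sqrt (rad1 lam \<beta> \<rho> n)"

definition alpha2 :: "(nat \<Rightarrow> real) \<Rightarrow> real \<Rightarrow> real \<Rightarrow> real \<Rightarrow> nat \<Rightarrow> real" where
  "alpha2 lam \<beta> \<rho> k n = sqrt (rad2 lam \<beta> \<rho> k n)"

definition alpha3 :: "(nat \<Rightarrow> real) \<Rightarrow> real \<Rightarrow> real \<Rightarrow> real \<Rightarrow> nat \<Rightarrow> real" where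
  "alpha3 lam \<beta> \<rho> k n = sqrt (rad3 lam \<beta> \<rho> k n)"

definition alpha4 :: "(nat \<Rightarrow> real) \<Rightarrow> real \<Rightarrow> real \<Rightarrow> real \<Rightarrow> nat \<Rightarrow> real" where
  "alpha4 lam \<beta> \<rho> k n = sqrt (rad4 lam \<beta> \<rho> k n)"

end

theory Submission
  imports Defs
begin

text \<open>
  On the line spanned by \<open>e\<^sub>n\<close> the weak system becomes
  \<open>s x + c x\<^sup>3 + \<kappa> (x - y) = 0 = s y + c y\<^sup>3 - \<kappa> (x - y)\<close> with \<open>s = \<lambda>\<^sub>n + \<beta>\<close>, \<open>c = \<rho> \<lambda>\<^sub>n\<close>,
  \<open>\<kappa> = k / \<lambda>\<^sub>n\<close>. Its sum and its difference factor through \<open>x + y\<close> and \<open>x - y\<close>. This leaves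
  \<open>x = y\<close>, or \<open>x = - y\<close>, or prescribed values of \<open>x y\<close> and \<open>x\<^sup>2 + y\<^sup>2\<close>, so that \<open>x\<^sup>2\<close> and \<open>y\<^sup>2\<close>
  are the two roots of a quadratic; as \<open>c (x + y)\<^sup>2 = - (s + 3 \<kappa>)\<close> in the last case, it gives
  something new only if \<open>s + 3 \<kappa> < 0\<close>.
\<close>

section \<open>The two-dimensional algebraic system\<close>

definition coupled_solutions :: "real \<Rightarrow> real \<Rightarrow> real \<Rightarrow> (real \<times> real) set" where
  "coupled_solutions s c \<kappa> = {(x, y). x \<noteq> 0 \<and> y \<noteq> 0 \<and>
     s * x + c * x ^ 3 + \<kappa> * (x - y) = 0 \<and> s * y + c * y ^ 3 - \<kappa> * (x - y) = 0}"

text \<open>On the diagonal \<open>y = x\<close> the difference equation is void and the sum,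
  divided by \<open>x\<close>, fixes \<open>c * x\<^sup>2\<close>; on \<open>y = - x\<close> the
  roles are exchanged. Off both lines the two cofactors vanish, and subtracting them isolates
  \<open>c * (x * y)\<close>. The alternatives may overlap: on either line the third one implies the
  first or the second.\<close>

lemma coupled_system_iff:
  fixes s c \<kappa> x y :: real
  assumes "x \<noteq> 0"
  shows "s * x + c * x ^ 3 + \<kappa> * (x - y) = 0 \<and> s * y + c * y ^ 3 - \<kappa> * (x - y) = 0 \<longleftrightarrow>
    y = x \<and> c * x\<^sup>2 = - s \<or>
    y = - x \<and> c * x\<^sup>2 = - (s + 2 * \<kappa>) \<or>
    c * (x * y) = - \<kappa> \<and> c * (x\<^sup>2 + y\<^sup>2) = - (s + \<kappa>)"
    (is "?E1 = 0 \<and> ?E2 = 0 \<longleftrightarrow> ?R")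
proof -
  have "?E1 = 0 \<and> ?E2 = 0 \<longleftrightarrow> ?E1 + ?E2 = 0 \<and> ?E1 - ?E2 = 0"
    by linarith
  also have "?E1 + ?E2 = (x + y) * (s + c * (x\<^sup>2 + y\<^sup>2) - c * (x * y))"
    by (simp add: power2_eq_square power3_eq_cube algebra_simps)
  also have "?E1 - ?E2 = (x - y) * (s + 2 * \<kappa> + c * (x\<^sup>2 + y\<^sup>2) + c * (x * y))"
    by (simp add: power2_eq_square power3_eq_cube algebra_simps)
  finally have *: "?E1 = 0 \<and> ?E2 = 0 \<longleftrightarrow>
      (y = - x \<or> s + c * (x\<^sup>2 + y\<^sup>2) - c * (x * y) = 0) \<and>
      (y = x \<or> s + 2 * \<kappa> + c * (x\<^sup>2 + y\<^sup>2) + c * (x * y) = 0)"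
    by auto
  show ?thesis
  proof (cases "y = x \<or> y = - x")
    case True
    then show ?thesis unfolding * using assms by (auto simp: power2_eq_square algebra_simps)
  next
    case False
    then show ?thesis unfolding * by auto
  qed
qed

text \<open>Vieta: \<open>x\<^sup>2\<close> must be a root of the monic quadratic with roots
  \<open>p\<^sup>2\<close> and \<open>q\<^sup>2\<close>. The negative product forces opposite signs,
  which leaves four pairs.\<close>

lemma square_pair_iff:
  fixes x y p q :: real
  assumes "0 < p" "0 < q"
  shows "x * y = - (p * q) \<and> x\<^sup>2 + y\<^sup>2 = p\<^sup>2 + q\<^sup>2 \<longleftrightarrow>
    (x, y) \<in> {(p, - q), (- p, q), (q, - p), (- q, p)}"
    (is "?L \<longleftrightarrow> ?R")
proof
  assume L: ?L
  have "x\<^sup>2 - (p\<^sup>2 + q\<^sup>2) = - y\<^sup>2" "p * q = - (x * y)" using L by linarith+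
  moreover have "(x\<^sup>2 - p\<^sup>2) * (x\<^sup>2 - q\<^sup>2) = x\<^sup>2 * (x\<^sup>2 - (p\<^sup>2 + q\<^sup>2)) + (p * q)\<^sup>2"
    by (simp add: power2_eq_square algebra_simps)
  ultimately have "(x\<^sup>2 - p\<^sup>2) * (x\<^sup>2 - q\<^sup>2) = x\<^sup>2 * (- y\<^sup>2) + (- (x * y))\<^sup>2"
    by simp
  also have "\<dots> = 0"
    by (simp add: power_mult_distrib)
  finally have "x = p \<or> x = - p \<or> x = q \<or> x = - q"
    by (simp add: power2_eq_iff)
  \<comment> \<open>The product determines \<open>y\<close> from \<open>x\<close>, so each of the
    four values of \<open>x\<close> contributes one pair.\<close>
  moreover have "y = - (p * q) / x"
    using L assms by (cases "x = 0") (auto simp: field_simps)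
  ultimately show ?R using assms by auto
next
  assume ?R
  then show ?L by auto
qed

text \<open>In the mixed alternative both unknowns are automatically nonzero, as their product is;
  on the two lines \<open>x \<noteq> 0\<close> has to be required.\<close>

lemma coupled_solutions_iff:
  assumes "0 < c" "0 < \<kappa>"
  shows "(x, y) \<in> coupled_solutions s c \<kappa> \<longleftrightarrow>
    x \<noteq> 0 \<and> y = x \<and> c * x\<^sup>2 = - s \<or>
    x \<noteq> 0 \<and> y = - x \<and> c * x\<^sup>2 = - (s + 2 * \<kappa>) \<or>
    c * (x * y) = - \<kappa> \<and> c * (x\<^sup>2 + y\<^sup>2) = - (s + \<kappa>)"
proof -
  have "x \<noteq> 0 \<and> y \<noteq> 0" if "c * (x * y) = - \<kappa>"
    using that assms by auto
  then show ?thesis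
    using coupled_system_iff[of x s c \<kappa> y] unfolding coupled_solutions_def by auto
qed

text \<open>Adding twice the product relation to the relation for the squares completes the square
  \<open>c * (x + y)\<^sup>2\<close>. In the equality case a mixed solution falls onto the line
  \<open>y = - x\<close>, which is why the threshold \<open>nu\<close> itself belongs to
  \<open>EE2\<close>.\<close>

lemma mixed_solution_bound:
  fixes s c \<kappa> x y :: real
  assumes "0 < c" "c * (x * y) = - \<kappa>" "c * (x\<^sup>2 + y\<^sup>2) = - (s + \<kappa>)"
  shows "s + 3 * \<kappa> \<le> 0" and "s + 3 * \<kappa> = 0 \<Longrightarrow> y = - x"
proof -
  have *: "c * (x + y)\<^sup>2 = - (s + 3 * \<kappa>)"
    using assms(2,3) by (simp add: power2_eq_square algebra_simps)
  moreover have "0 \<le> c * (x + y)\<^sup>2" using assms(1) by simp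
  ultimately show "s + 3 * \<kappa> \<le> 0" by linarith
  show "y = - x" if "s + 3 * \<kappa> = 0"
    using * that assms(1) by auto
qed

text \<open>The left-hand sides have the shape of the first two alternatives in
  \<open>coupled_solutions_iff\<close>, which can thus be rewritten into explicit pairs.\<close>

lemma scaled_square_eq_iff:
  fixes c a x y :: real
  assumes "0 < c" "0 < a"
  defines "r \<equiv> sqrt (a / c)"
  shows "x \<noteq> 0 \<and> y = x \<and> c * x\<^sup>2 = a \<longleftrightarrow> (x, y) \<in> {(r, r), (- r, - r)}"
    and "x \<noteq> 0 \<and> y = - x \<and> c * x\<^sup>2 = a \<longleftrightarrow> (x, y) \<in> {(r, - r), (- r, r)}"
proof -
  have r: "0 < r" "r\<^sup>2 = a / c" unfolding r_def using assms(1,2) by simp_all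
  have "c * x\<^sup>2 = a \<longleftrightarrow> x\<^sup>2 = r\<^sup>2"
    unfolding r(2) using assms(1) by (auto simp: field_simps)
  then have *: "c * x\<^sup>2 = a \<longleftrightarrow> x = r \<or> x = - r"
    by (simp add: power2_eq_iff)
  show "x \<noteq> 0 \<and> y = x \<and> c * x\<^sup>2 = a \<longleftrightarrow> (x, y) \<in> {(r, r), (- r, - r)}"
    "x \<noteq> 0 \<and> y = - x \<and> c * x\<^sup>2 = a \<longleftrightarrow> (x, y) \<in> {(r, - r), (- r, r)}"
    unfolding * using r(1) by auto
qed

text \<open>Rules out a line alternative once its threshold is not exceeded. The boundary value
  \<open>a = 0\<close> is included, in accordance with \<open>mu\<close> itself belonging to
  \<open>EE1\<close>.\<close>

lemma scaled_square_nonpos: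
  fixes c a x :: real
  assumes "0 < c" "a \<le> 0" "c * x\<^sup>2 = a"
  shows "x = 0"
  using assms by (metis linorder_not_le mult_pos_pos zero_less_power2)

section \<open>The reduced system according to the position of \<open>s\<close> relative to 0,
  \<open>- 2 * \<kappa>\<close> and \<open>- 3 * \<kappa>\<close>\<close>

context
  fixes s c \<kappa> :: real
  assumes c: "0 < c" and \<kappa>: "0 < \<kappa>"
begin

text \<open>Energy argument: multiply the equations by \<open>x\<close> and \<open>y\<close> and
  add. The coupling turns into \<open>\<kappa> * (x - y)\<^sup>2\<close>, every term is nonnegative,
  and the quartic term alone forces both unknowns to vanish, even for \<open>s = 0\<close>.\<close>

lemma trivial_if_nonneg:
  assumes "0 \<le> s" "s * x + c * x ^ 3 + \<kappa> * (x - y) = 0" "s * y + c * y ^ 3 - \<kappa> * (x - y) = 0"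
  shows "x = 0 \<and> y = 0"
proof -
  have "s * (x\<^sup>2 + y\<^sup>2) + c * (x ^ 4 + y ^ 4) + \<kappa> * (x - y)\<^sup>2 =
      x * (s * x + c * x ^ 3 + \<kappa> * (x - y)) + y * (s * y + c * y ^ 3 - \<kappa> * (x - y))"
    by (simp add: power2_eq_square power3_eq_cube power4_eq_xxxx algebra_simps)
  then have "s * (x\<^sup>2 + y\<^sup>2) + c * (x ^ 4 + y ^ 4) + \<kappa> * (x - y)\<^sup>2 = 0"
    using assms by simp
  moreover have "0 \<le> s * (x\<^sup>2 + y\<^sup>2)" "0 \<le> \<kappa> * (x - y)\<^sup>2" "0 \<le> x ^ 4" "0 \<le> y ^ 4"
    using assms(1) \<kappa> by auto
  moreover from this have "0 \<le> c * (x ^ 4 + y ^ 4)" using c by simp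
  ultimately have "c * (x ^ 4 + y ^ 4) = 0" by linarith
  then have "x ^ 4 = 0 \<and> y ^ 4 = 0"
    using c \<open>0 \<le> x ^ 4\<close> \<open>0 \<le> y ^ 4\<close> by (simp add: add_nonneg_eq_0_iff)
  then show ?thesis by simp
qed

text \<open>The line \<open>y = - x\<close> would need a square that is not positive, and
  \<open>s + 3 * \<kappa> > 0\<close> excludes mixed solutions, so only the diagonal
  remains.\<close>

lemma coupled_solutions_one:
  assumes "s < 0" "0 \<le> s + 2 * \<kappa>"
  defines "a \<equiv> sqrt (- s / c)"
  shows "coupled_solutions s c \<kappa> = {(a, a), (- a, - a)}"
proof -
  have "(x, y) \<in> coupled_solutions s c \<kappa> \<longleftrightarrow> (x, y) \<in> {(a, a), (- a, - a)}" for x y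
  proof -
    have "0 < - s" "- (s + 2 * \<kappa>) \<le> 0" "\<not> s + 3 * \<kappa> \<le> 0" using assms(1,2) \<kappa> by linarith+
    then show ?thesis
      unfolding coupled_solutions_iff[OF c \<kappa>] a_def
      using scaled_square_eq_iff(1)[OF c, of "- s" x y] scaled_square_nonpos[OF c, of "- (s + 2 * \<kappa>)" x]
        mixed_solution_bound(1)[OF c, of x y \<kappa> s] by blast
  qed
  then show ?thesis by (simp add: set_eq_iff)
qed

lemma coupled_solutions_two:
  assumes "s + 2 * \<kappa> < 0" "0 \<le> s + 3 * \<kappa>"
  defines "a \<equiv> sqrt (- s / c)" and "b \<equiv> sqrt (- (s + 2 * \<kappa>) / c)"
  shows "coupled_solutions s c \<kappa> = {(a, a), (- a, - a), (b, - b), (- b, b)}"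
proof -
  \<comment> \<open>Mixed solutions survive only at \<open>s = - 3 * \<kappa>\<close>. There
    \<open>c * x\<^sup>2 = \<kappa> = - (s + 2 * \<kappa>)\<close>, so they are already counted on
    the line \<open>y = - x\<close>.\<close>
  have "x \<noteq> 0 \<and> y = - x \<and> c * x\<^sup>2 = - (s + 2 * \<kappa>)"
    if "c * (x * y) = - \<kappa>" "c * (x\<^sup>2 + y\<^sup>2) = - (s + \<kappa>)" for x y
  proof -
    have "s + 3 * \<kappa> = 0" using mixed_solution_bound(1)[OF c that] assms(2) by simp
    moreover from this have "y = - x" by (rule mixed_solution_bound(2)[OF c that])
    ultimately show ?thesis using that \<kappa> by (auto simp: power2_eq_square)
  qed
  then have iff: "(x, y) \<in> coupled_solutions s c \<kappa> \<longleftrightarrow>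
      x \<noteq> 0 \<and> y = x \<and> c * x\<^sup>2 = - s \<or> x \<noteq> 0 \<and> y = - x \<and> c * x\<^sup>2 = - (s + 2 * \<kappa>)" for x y
    unfolding coupled_solutions_iff[OF c \<kappa>] by metis
  have s: "0 < - s" "0 < - (s + 2 * \<kappa>)" using assms(1) \<kappa> by linarith+
  have "(x, y) \<in> coupled_solutions s c \<kappa> \<longleftrightarrow>
      (x, y) \<in> {(a, a), (- a, - a)} \<union> {(b, - b), (- b, b)}" for x y
    unfolding iff Un_iff a_def b_def
      scaled_square_eq_iff(1)[OF c s(1)] scaled_square_eq_iff(2)[OF c s(2)] ..
  then have "coupled_solutions s c \<kappa> = {(a, a), (- a, - a)} \<union> {(b, - b), (- b, b)}"
    by (simp only: set_eq_iff split_paired_All simp_thms)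
  then show ?thesis by (simp only: Un_insert_left Un_empty_left)
qed

text \<open>\<open>r\<close> and \<open>t\<close> are the roots of the monic quadratic with root sum
  \<open>- (s + \<kappa>) / c\<close> and root product \<open>(\<kappa> / c)\<^sup>2\<close>, the
  values imposed on \<open>x\<^sup>2\<close> and \<open>y\<^sup>2\<close> by the mixed alternative;
  \<open>d\<close> is \<open>c\<^sup>2\<close> times its discriminant. Both factors of
  \<open>d\<close> are negative, and \<open>d < (s + \<kappa>)\<^sup>2\<close> keeps the smaller
  root positive.\<close>

lemma quadratic_roots_pos:
  assumes "s + 3 * \<kappa> < 0"
  defines "d \<equiv> (s - \<kappa>) * (s + 3 * \<kappa>)"
  defines "r \<equiv> (- (s + \<kappa>) + sqrt d) / (2 * c)" and "t \<equiv> (- (s + \<kappa>) - sqrt d) / (2 * c)"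
  shows "0 < d" "0 < t" "t < r" "r + t = - (s + \<kappa>) / c" "r * t = (\<kappa> / c)\<^sup>2"
proof -
  show d: "0 < d" unfolding d_def using assms(1) \<kappa> by (intro mult_neg_neg) auto
  have d_eq: "d = (s + \<kappa>)\<^sup>2 - 4 * \<kappa>\<^sup>2"
    unfolding d_def by (simp add: power2_eq_square algebra_simps)
  then have "d < (- (s + \<kappa>))\<^sup>2" unfolding power2_minus using \<kappa> by simp
  then have "sqrt d < - (s + \<kappa>)"
    using assms(1) \<kappa> by (intro real_less_lsqrt) auto
  then show "0 < t" unfolding t_def using c by simp
  show "t < r" unfolding t_def r_def using d c by (simp add: divide_strict_right_mono)
  show "r + t = - (s + \<kappa>) / c" unfolding t_def r_def using c by (simp add: field_simps)
  have "r * t = ((s + \<kappa>)\<^sup>2 - (sqrt d)\<^sup>2) / (2 * c)\<^sup>2"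
    unfolding t_def r_def by (simp add: power2_eq_square algebra_simps add_divide_distrib diff_divide_distrib)
  also have "\<dots> = (\<kappa> / c)\<^sup>2"
    using d d_eq c by (simp add: power_divide power_mult_distrib)
  finally show "r * t = (\<kappa> / c)\<^sup>2" .
qed

lemma coupled_solutions_three:
  assumes "s + 3 * \<kappa> < 0"
  defines "a \<equiv> sqrt (- s / c)" and "b \<equiv> sqrt (- (s + 2 * \<kappa>) / c)"
    and "p \<equiv> sqrt ((- (s + \<kappa>) + sqrt ((s - \<kappa>) * (s + 3 * \<kappa>))) / (2 * c))"
    and "q \<equiv> sqrt ((- (s + \<kappa>) - sqrt ((s - \<kappa>) * (s + 3 * \<kappa>))) / (2 * c))"
  shows "coupled_solutions s c \<kappa> = {(a, a), (- a, - a), (b, - b), (- b, b),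
    (p, - q), (- p, q), (q, - p), (- q, p)}"
proof -
  note roots = quadratic_roots_pos[OF assms(1)]
  have pq: "0 < p" "0 < q" unfolding p_def q_def using roots(2,3) by simp_all
  have "p\<^sup>2 + q\<^sup>2 = - (s + \<kappa>) / c"
    unfolding p_def q_def using roots(2-4) by simp
  \<comment> \<open>The root product is a perfect square, so the nested radicals collapse and the
    mixed alternative takes the form treated in \<open>square_pair_iff\<close>.\<close>
  moreover have "p * q = \<kappa> / c"
    unfolding p_def q_def real_sqrt_mult[symmetric] roots(5) using c \<kappa> by simp
  ultimately have mixed: "c * (x * y) = - \<kappa> \<and> c * (x\<^sup>2 + y\<^sup>2) = - (s + \<kappa>) \<longleftrightarrow>
      x * y = - (p * q) \<and> x\<^sup>2 + y\<^sup>2 = p\<^sup>2 + q\<^sup>2" for x y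
    using c by (metis minus_divide_left nonzero_mult_div_cancel_left nonzero_eq_divide_eq
        mult.commute order_less_irrefl)
  have s: "0 < - s" "0 < - (s + 2 * \<kappa>)" using assms(1) \<kappa> by linarith+
  have "(x, y) \<in> coupled_solutions s c \<kappa> \<longleftrightarrow>
      (x, y) \<in> {(a, a), (- a, - a)} \<union> {(b, - b), (- b, b)} \<union>
        {(p, - q), (- p, q), (q, - p), (- q, p)}" for x y
    unfolding coupled_solutions_iff[OF c \<kappa>] Un_iff mixed square_pair_iff[OF pq] a_def b_def
      scaled_square_eq_iff(1)[OF c s(1)] scaled_square_eq_iff(2)[OF c s(2)]
    by (simp only: disj_assoc)
  then have "coupled_solutions s c \<kappa> = {(a, a), (- a, - a)} \<union> {(b, - b), (- b, b)} \<union>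
      {(p, - q), (- p, q), (q, - p), (- q, p)}"
    by (simp only: set_eq_iff split_paired_All simp_thms)
  then show ?thesis by (simp only: Un_insert_left Un_empty_left)
qed

end

section \<open>Reduction to the algebraic system\<close>

context simple_spectrum_operator
begin

text \<open>Membership in the domain makes the defining series converge, whereas
  \<open>infsum\<close> of a non-summable family is 0 by convention. A continuous functional may
  therefore be applied term by term.\<close>

lemma op_power_inner_e:
  assumes "u \<in> pow_domain lam e s" "m \<ge> 1"
  shows "op_power lam e s u \<bullet> e m = lam m powr s * (u \<bullet> e m)"
proof -
  let ?f = "\<lambda>n. (lam n powr s * (u \<bullet> e n)) *\<^sub>R e n"
  have "?f summable_on {1..}"
    using assms(1) by (intro summable_e) (simp add: pow_domain_def)
  then have "(?f has_sum op_power lam e s u) {1..}"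
    unfolding op_power_def by (rule has_sum_infsum)
  then have "((\<lambda>n. ?f n \<bullet> e m) has_sum (op_power lam e s u \<bullet> e m)) {1..}"
    using has_sum_bounded_linear[OF bounded_linear_inner_left] by (force simp: o_def)
  moreover have "((\<lambda>n. ?f n \<bullet> e m) has_sum (lam m powr s * (u \<bullet> e m))) {1..}"
    by (rule has_sum_finite_neutralI[of "{m}"]) (use assms(2) in \<open>auto simp: e_orthonormal\<close>)
  ultimately show ?thesis by (rule has_sum_unique)
qed

lemma op_power_e:
  assumes "n \<ge> 1"
  shows "op_power lam e s (x *\<^sub>R e n) = (lam n powr s * x) *\<^sub>R e n"
proof -
  have "((\<lambda>m. (lam m powr s * ((x *\<^sub>R e n) \<bullet> e m)) *\<^sub>R e m) has_sum ((lam n powr s * x) *\<^sub>R e n)) {1..}"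
    by (rule has_sum_finite_neutralI[of "{n}"]) (use assms in \<open>auto simp: e_orthonormal\<close>)
  then show ?thesis unfolding op_power_def by (rule infsumI)
qed

text \<open>\<open>lam n powr s\<close> is at most 1 if \<open>lam n \<le> 1\<close> and at most
  \<open>lam n powr t\<close> otherwise, so the Bessel series plus the given series dominates. This
  puts test functions from \<open>Hspace lam e 2\<close> into \<open>Hspace lam e 1\<close>.\<close>

lemma pow_domain_mono:
  assumes "u \<in> pow_domain lam e t" "0 \<le> s" "s \<le> t"
  shows "u \<in> pow_domain lam e s"
proof -
  have "(\<lambda>n. (u \<bullet> e n)\<^sup>2 + (lam n powr t * (u \<bullet> e n))\<^sup>2) summable_on {1..}"
    using assms(1) by (intro summable_on_add bessel) (simp add: pow_domain_def)
  then show ?thesis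
    unfolding pow_domain_def mem_Collect_eq
  proof (rule summable_on_comparison_test)
    fix n :: nat assume "n \<in> {1..}"
    then have "0 < lam n" using lam_pos by simp
    show "(lam n powr s * (u \<bullet> e n))\<^sup>2 \<le> (u \<bullet> e n)\<^sup>2 + (lam n powr t * (u \<bullet> e n))\<^sup>2"
    proof (cases "lam n \<le> 1")
      case True
      then have "lam n powr s \<le> 1" using \<open>0 < lam n\<close> assms(2) by (intro powr_le1) auto
      then have "(lam n powr s * (u \<bullet> e n))\<^sup>2 \<le> (1 * (u \<bullet> e n))\<^sup>2"
        unfolding power_mult_distrib by (intro mult_right_mono power_mono) auto
      then show ?thesis by (simp add: add_increasing2)
    next
      case False
      then have "lam n powr s \<le> lam n powr t" using assms(3) by (intro powr_mono) auto
      then have "(lam n powr s * (u \<bullet> e n))\<^sup>2 \<le> (lam n powr t * (u \<bullet> e n))\<^sup>2"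
        unfolding power_mult_distrib by (intro mult_right_mono power_mono) auto
      then show ?thesis by (simp add: add_increasing)
    qed
  qed simp
qed

lemma e_nonzero: "n \<ge> 1 \<Longrightarrow> e n \<noteq> 0"
  using e_orthonormal[of n n] by auto

lemma scaleR_e_in_Hspace_two: "n \<ge> 1 \<Longrightarrow> x *\<^sub>R e n \<in> Hspace lam e 2"
  using e_eigenvector[of n] selfadjoint
  by (auto simp: Hspace_def pow_domain_one eigenspace_def selfadjoint_operator_def
      linear_operator_def subspace_scale)

text \<open>The left factor stays on the line of \<open>e n\<close>, so only the coefficient
  \<open>\<phi> \<bullet> e n\<close> of the test function is seen, and the two half powers of
  \<open>lam n\<close> combine.\<close>

lemma Hinner_e:
  assumes "n \<ge> 1" "\<phi> \<in> Hspace lam e r"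
  shows "Hinner lam e r (x *\<^sub>R e n) \<phi> = lam n powr r * x * (\<phi> \<bullet> e n)"
proof -
  have "Hinner lam e r (x *\<^sub>R e n) \<phi> = lam n powr (r / 2) * lam n powr (r / 2) * x * (\<phi> \<bullet> e n)"
    using op_power_inner_e[of \<phi> "r / 2" n] assms
    by (simp add: Hinner_def Hspace_def op_power_e inner_commute)
  then show ?thesis by (simp add: powr_add[symmetric])
qed

lemma stiffness_e:
  assumes "n \<ge> 1"
  shows "stiffness lam e \<beta> \<rho> (x *\<^sub>R e n) = \<beta> + \<rho> * lam n * x\<^sup>2"
proof -
  have "(Hnorm lam e 1 (x *\<^sub>R e n))\<^sup>2 = (lam n powr (1/2))\<^sup>2 * x\<^sup>2"
    using assms e_orthonormal[of n n]
    by (simp add: Hnorm_def op_power_e power_mult_distrib power2_norm_eq_inner)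
  also have "(lam n powr (1/2))\<^sup>2 = lam n"
    using lam_pos[OF assms] by (simp add: powr_half_sqrt)
  finally show ?thesis by (simp add: stiffness_def)
qed

text \<open>Each weak equation is its scalar equation times
  \<open>lam n * (\<phi> \<bullet> e n)\<close>. Extracting the common factor \<open>lam n\<close>
  is what turns the coupling constant into \<open>k / lam n\<close>.\<close>

lemma weak_solution_e_iff:
  assumes n: "n \<ge> 1"
  shows "weak_solution lam e \<beta> \<rho> k (x *\<^sub>R e n, y *\<^sub>R e n) \<longleftrightarrow>
    (lam n + \<beta>) * x + (\<rho> * lam n) * x ^ 3 + (k / lam n) * (x - y) = 0 \<and>
    (lam n + \<beta>) * y + (\<rho> * lam n) * y ^ 3 - (k / lam n) * (x - y) = 0"
    (is "_ \<longleftrightarrow> ?E1 = 0 \<and> ?E2 = 0")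
proof -
  have L: "0 < lam n" using lam_pos n by blast
  have sub: "\<phi> \<in> Hspace lam e 1" if "\<phi> \<in> Hspace lam e 2" for \<phi>
    using that pow_domain_mono[of \<phi> 1 "1/2"] by (simp add: Hspace_def)
  have 1: "Hinner lam e 2 (x *\<^sub>R e n) \<phi> + stiffness lam e \<beta> \<rho> (x *\<^sub>R e n) * Hinner lam e 1 (x *\<^sub>R e n) \<phi>
      + k * ((x *\<^sub>R e n - y *\<^sub>R e n) \<bullet> \<phi>) = lam n * ?E1 * (\<phi> \<bullet> e n)"
    if "\<phi> \<in> Hspace lam e 2" for \<phi>
    using L that sub[OF that]
    by (simp add: Hinner_e[OF n] stiffness_e[OF n] inner_diff_left inner_commute[of "e n"])
      (simp add: power2_eq_square power3_eq_cube field_simps)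
  have 2: "Hinner lam e 2 (y *\<^sub>R e n) \<phi> + stiffness lam e \<beta> \<rho> (y *\<^sub>R e n) * Hinner lam e 1 (y *\<^sub>R e n) \<phi>
      - k * ((x *\<^sub>R e n - y *\<^sub>R e n) \<bullet> \<phi>) = lam n * ?E2 * (\<phi> \<bullet> e n)"
    if "\<phi> \<in> Hspace lam e 2" for \<phi>
    using L that sub[OF that]
    by (simp add: Hinner_e[OF n] stiffness_e[OF n] inner_diff_left inner_commute[of "e n"])
      (simp add: power2_eq_square power3_eq_cube field_simps)
  have e: "e n \<in> Hspace lam e 2" "e n \<bullet> e n = 1"
    using scaleR_e_in_Hspace_two[OF n, of 1] e_orthonormal[OF n n] by simp_all
  have "weak_solution lam e \<beta> \<rho> k (x *\<^sub>R e n, y *\<^sub>R e n) \<longleftrightarrow>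
      (\<forall>\<phi>\<in>Hspace lam e 2. \<forall>\<psi>\<in>Hspace lam e 2.
        lam n * ?E1 * (\<phi> \<bullet> e n) = 0 \<and> lam n * ?E2 * (\<psi> \<bullet> e n) = 0)"
    \<comment> \<open>\<open>ball_cong\<close> supplies the membership of the test functions that
      both identities have as a premise.\<close>
    unfolding weak_solution_def by (simp only: prod.case 1 2 scaleR_e_in_Hspace_two[OF n] simp_thms cong: ball_cong)
  also have "\<dots> \<longleftrightarrow> ?E1 = 0 \<and> ?E2 = 0"
  proof
    assume *: "\<forall>\<phi>\<in>Hspace lam e 2. \<forall>\<psi>\<in>Hspace lam e 2.
        lam n * ?E1 * (\<phi> \<bullet> e n) = 0 \<and> lam n * ?E2 * (\<psi> \<bullet> e n) = 0"
    \<comment> \<open>Testing both equations with \<open>e n\<close> itself suffices.\<close>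
    show "?E1 = 0 \<and> ?E2 = 0"
      using *[rule_format, OF e(1) e(1)] L unfolding e(2) by (simp del: times_divide_eq_left)
  qed simp
  finally show ?thesis .
qed

lemma unimodal_solutions_eq_image:
  assumes "n \<ge> 1"
  shows "unimodal_solutions lam e \<beta> \<rho> k n =
    (\<lambda>(x, y). (x *\<^sub>R e n, y *\<^sub>R e n)) ` coupled_solutions (lam n + \<beta>) (\<rho> * lam n) (k / lam n)"
  unfolding unimodal_solutions_def coupled_solutions_def
  using weak_solution_e_iff[OF assms] by (auto simp: image_iff)

lemma card_unimodal_solutions:
  assumes "n \<ge> 1"
  shows "card (unimodal_solutions lam e \<beta> \<rho> k n) =
    card (coupled_solutions (lam n + \<beta>) (\<rho> * lam n) (k / lam n))"
  unfolding unimodal_solutions_eq_image[OF assms]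
  using e_nonzero[OF assms] by (intro card_image) (auto simp: inj_on_def)

text \<open>A common element would have a component along both \<open>e m\<close> and
  \<open>e n\<close>; pairing with \<open>e m\<close> makes its coefficient vanish, contrary to
  nontriviality.\<close>

lemma unimodal_solutions_disjoint:
  assumes "m \<ge> 1" "n \<ge> 1" "m \<noteq> n"
  shows "unimodal_solutions lam e \<beta> \<rho> k m \<inter> unimodal_solutions lam e \<beta> \<rho> k n = {}"
proof -
  have "x = 0" if "x *\<^sub>R e m = y *\<^sub>R e n" for x y
    using arg_cong[OF that, of "\<lambda>v. v \<bullet> e m"] assms by (simp add: e_orthonormal)
  then show ?thesis unfolding unimodal_solutions_def by fastforce
qed

text \<open>Since the eigenvalues tend to infinity, only finitely many lie below
  \<open>- \<beta>\<close>; hence the cardinalities in the final count are genuine ones.\<close>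

lemma finite_EE: "finite (EE lam \<beta>)"
proof -
  obtain N where "\<And>n. n \<ge> N \<Longrightarrow> - \<beta> \<le> lam n"
    using lam_at_top unfolding filterlim_at_top eventually_sequentially by blast
  then have "EE lam \<beta> \<subseteq> {..<N}"
    unfolding EE_def by (fastforce simp: not_less[symmetric])
  then show ?thesis by (rule finite_subset) simp
qed

end

section \<open>Classification of the unimodal solutions\<close>

context simple_spectrum_operator
begin

context
  fixes \<beta> \<rho> k :: real and n :: nat
  assumes \<rho>: "0 < \<rho>" and k: "0 < k" and n: "n \<ge> 1"
begin

lemma coefficients_pos: "0 < \<rho> * lam n" "0 < k / lam n"
  using \<rho> k lam_pos[OF n] by simp_all

text \<open>Translation into \<open>s = lam n + \<beta>\<close>, \<open>c = \<rho> * lam n\<close>,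
  \<open>\<kappa> = k / lam n\<close>: as \<open>mu\<close> and \<open>nu\<close> exceed
  \<open>lam n\<close> by \<open>2 * \<kappa>\<close> and \<open>3 * \<kappa>\<close>, their
  difference in the amplitudes is \<open>- \<kappa>\<close>.\<close>

lemma radicand_eqs:
  "rad1 lam \<beta> \<rho> n = - (lam n + \<beta>) / (\<rho> * lam n)"
  "rad2 lam \<beta> \<rho> k n = - (lam n + \<beta> + 2 * (k / lam n)) / (\<rho> * lam n)"
  "disc lam \<beta> k n = (lam n + \<beta> - k / lam n) * (lam n + \<beta> + 3 * (k / lam n))"
  "rad3 lam \<beta> \<rho> k n = (- (lam n + \<beta> + k / lam n) + sqrt (disc lam \<beta> k n)) / (2 * (\<rho> * lam n))"
  "rad4 lam \<beta> \<rho> k n = (- (lam n + \<beta> + k / lam n) - sqrt (disc lam \<beta> k n)) / (2 * (\<rho> * lam n))"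
proof -
  have mn: "mu lam k n = 2 * (k / lam n) + lam n" "nu lam k n = 3 * (k / lam n) + lam n"
    by (simp_all add: mu_def nu_def)
  show "rad1 lam \<beta> \<rho> n = - (lam n + \<beta>) / (\<rho> * lam n)"
    unfolding rad1_def by simp
  show "rad2 lam \<beta> \<rho> k n = - (lam n + \<beta> + 2 * (k / lam n)) / (\<rho> * lam n)"
    \<comment> \<open>Splitting the quotient leaves numerators that are linear in the atom
      \<open>k / lam n\<close>.\<close>
    unfolding rad2_def mn by (rule arg_cong2[of _ _ _ _ "(/)"]) linarith+
  show "disc lam \<beta> k n = (lam n + \<beta> - k / lam n) * (lam n + \<beta> + 3 * (k / lam n))"
    unfolding disc_def mn by (rule arg_cong2[of _ _ _ _ "(*)"]) linarith+
  show "rad3 lam \<beta> \<rho> k n = (- (lam n + \<beta> + k / lam n) + sqrt (disc lam \<beta> k n)) / (2 * (\<rho> * lam n))"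
    unfolding rad3_def mn by (rule arg_cong2[of _ _ _ _ "(/)"]) (linarith | simp)+
  show "rad4 lam \<beta> \<rho> k n = (- (lam n + \<beta> + k / lam n) - sqrt (disc lam \<beta> k n)) / (2 * (\<rho> * lam n))"
    unfolding rad4_def mn by (rule arg_cong2[of _ _ _ _ "(/)"]) (linarith | simp)+
qed

lemma EE_iffs:
  "n \<in> EE lam \<beta> \<longleftrightarrow> lam n + \<beta> < 0"
  "n \<in> EE1 lam \<beta> k \<longleftrightarrow> lam n + \<beta> < 0 \<and> 0 \<le> lam n + \<beta> + 2 * (k / lam n)"
  "n \<in> EE2 lam \<beta> k \<longleftrightarrow> lam n + \<beta> + 2 * (k / lam n) < 0 \<and> 0 \<le> lam n + \<beta> + 3 * (k / lam n)"
  "n \<in> EE3 lam \<beta> k \<longleftrightarrow> lam n + \<beta> + 3 * (k / lam n) < 0"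
  using n by (auto simp: EE_def EE1_def EE2_def EE3_def mu_def nu_def)

lemma unimodal_EE1:
  assumes "n \<in> EE1 lam \<beta> k"
  defines "a \<equiv> alpha1 lam \<beta> \<rho> n" and "U \<equiv> unimodal_solutions lam e \<beta> \<rho> k n"
  shows "0 \<le> rad1 lam \<beta> \<rho> n" "card U = 2"
    "U = {(a *\<^sub>R e n, a *\<^sub>R e n), ((- a) *\<^sub>R e n, (- a) *\<^sub>R e n)}"
proof -
  have s: "lam n + \<beta> < 0" "0 \<le> lam n + \<beta> + 2 * (k / lam n)"
    using assms(1) by (simp_all add: EE_iffs)
  have r: "0 < rad1 lam \<beta> \<rho> n"
    unfolding radicand_eqs using s coefficients_pos by (intro divide_pos_pos) auto
  then show "0 \<le> rad1 lam \<beta> \<rho> n" by simp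
  have a: "0 < a" using r by (simp add: a_def alpha1_def)
  have S: "coupled_solutions (lam n + \<beta>) (\<rho> * lam n) (k / lam n) = {(a, a), (- a, - a)}"
    unfolding a_def alpha1_def radicand_eqs by (rule coupled_solutions_one[OF coefficients_pos s])
  show "card U = 2" unfolding U_def card_unimodal_solutions[OF n] S using a by simp
  show "U = {(a *\<^sub>R e n, a *\<^sub>R e n), ((- a) *\<^sub>R e n, (- a) *\<^sub>R e n)}"
    unfolding U_def unimodal_solutions_eq_image[OF n] S by simp
qed

lemma unimodal_EE2:
  assumes "n \<in> EE2 lam \<beta> k"
  defines "a \<equiv> alpha1 lam \<beta> \<rho> n" and "b \<equiv> alpha2 lam \<beta> \<rho> k n"
    and "U \<equiv> unimodal_solutions lam e \<beta> \<rho> k n"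
  shows "0 \<le> rad1 lam \<beta> \<rho> n" "0 \<le> rad2 lam \<beta> \<rho> k n" "card U = 4"
    "U = {(a *\<^sub>R e n, a *\<^sub>R e n), ((- a) *\<^sub>R e n, (- a) *\<^sub>R e n),
          (b *\<^sub>R e n, (- b) *\<^sub>R e n), ((- b) *\<^sub>R e n, b *\<^sub>R e n)}"
proof -
  have s: "lam n + \<beta> + 2 * (k / lam n) < 0" "0 \<le> lam n + \<beta> + 3 * (k / lam n)"
    using assms(1) by (simp_all add: EE_iffs)
  have r: "0 < rad1 lam \<beta> \<rho> n" "0 < rad2 lam \<beta> \<rho> k n"
    unfolding radicand_eqs using s coefficients_pos by (auto intro!: divide_pos_pos)
  then show "0 \<le> rad1 lam \<beta> \<rho> n" "0 \<le> rad2 lam \<beta> \<rho> k n" by simp_all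
  have ab: "0 < a" "0 < b" using r by (simp_all add: a_def alpha1_def b_def alpha2_def)
  have S: "coupled_solutions (lam n + \<beta>) (\<rho> * lam n) (k / lam n) =
      {(a, a), (- a, - a), (b, - b), (- b, b)}"
    unfolding a_def b_def alpha1_def alpha2_def radicand_eqs
    by (rule coupled_solutions_two[OF coefficients_pos s])
  show "card U = 4" unfolding U_def card_unimodal_solutions[OF n] S using ab by simp
  show "U = {(a *\<^sub>R e n, a *\<^sub>R e n), ((- a) *\<^sub>R e n, (- a) *\<^sub>R e n),
          (b *\<^sub>R e n, (- b) *\<^sub>R e n), ((- b) *\<^sub>R e n, b *\<^sub>R e n)}"
    unfolding U_def unimodal_solutions_eq_image[OF n] S by simp
qed

lemma unimodal_EE3:
  assumes "n \<in> EE3 lam \<beta> k"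
  defines "a \<equiv> alpha1 lam \<beta> \<rho> n" and "b \<equiv> alpha2 lam \<beta> \<rho> k n"
    and "p \<equiv> alpha3 lam \<beta> \<rho> k n" and "q \<equiv> alpha4 lam \<beta> \<rho> k n"
    and "U \<equiv> unimodal_solutions lam e \<beta> \<rho> k n"
  shows "0 \<le> rad1 lam \<beta> \<rho> n" "0 \<le> rad2 lam \<beta> \<rho> k n" "0 \<le> disc lam \<beta> k n"
    "0 \<le> rad3 lam \<beta> \<rho> k n" "0 \<le> rad4 lam \<beta> \<rho> k n" "card U = 8"
    "U = {(a *\<^sub>R e n, a *\<^sub>R e n), ((- a) *\<^sub>R e n, (- a) *\<^sub>R e n),
          (b *\<^sub>R e n, (- b) *\<^sub>R e n), ((- b) *\<^sub>R e n, b *\<^sub>R e n),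
          (p *\<^sub>R e n, (- q) *\<^sub>R e n), ((- p) *\<^sub>R e n, q *\<^sub>R e n),
          (q *\<^sub>R e n, (- p) *\<^sub>R e n), ((- q) *\<^sub>R e n, p *\<^sub>R e n)}"
proof -
  have s: "lam n + \<beta> + 3 * (k / lam n) < 0"
    using assms(1) by (simp add: EE_iffs)
  note roots = quadratic_roots_pos[OF coefficients_pos s]
  have r: "0 < rad1 lam \<beta> \<rho> n" "0 < rad2 lam \<beta> \<rho> k n"
    unfolding radicand_eqs using s coefficients_pos by (auto intro!: divide_pos_pos)
  have r': "0 < disc lam \<beta> k n" "0 < rad4 lam \<beta> \<rho> k n" "rad4 lam \<beta> \<rho> k n < rad3 lam \<beta> \<rho> k n"
    unfolding radicand_eqs using roots(1-3) by blast+
  show "0 \<le> rad1 lam \<beta> \<rho> n" "0 \<le> rad2 lam \<beta> \<rho> k n" "0 \<le> disc lam \<beta> k n"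
    "0 \<le> rad3 lam \<beta> \<rho> k n" "0 \<le> rad4 lam \<beta> \<rho> k n"
    using r r' by linarith+
  have ab: "0 < a" "0 < b" "0 < q" "q < p"
    using r r' by (simp_all add: a_def alpha1_def b_def alpha2_def p_def q_def alpha3_def alpha4_def)
  have S: "coupled_solutions (lam n + \<beta>) (\<rho> * lam n) (k / lam n) =
      {(a, a), (- a, - a), (b, - b), (- b, b), (p, - q), (- p, q), (q, - p), (- q, p)}"
    unfolding a_def b_def p_def q_def alpha1_def alpha2_def alpha3_def alpha4_def radicand_eqs
    by (rule coupled_solutions_three[OF coefficients_pos s])
  \<comment> \<open>From \<open>0 < q < p\<close>: the opposite signs keep mixed pairs off the
    diagonal, and \<open>p \<noteq> q\<close> keeps them off the line \<open>y = - x\<close> and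
    apart from each other.\<close>
  have "a \<noteq> 0" "b \<noteq> 0" "p \<noteq> 0" "q \<noteq> 0" "p \<noteq> q" "q \<noteq> p"
    "a \<noteq> - a" "b \<noteq> - b" "p \<noteq> - p" "q \<noteq> - q" "p \<noteq> - q" "- p \<noteq> q" "q \<noteq> - p" "- q \<noteq> p"
    using ab by linarith+
  then have "card {(a, a), (- a, - a), (b, - b), (- b, b), (p, - q), (- p, q), (q, - p), (- q, p)} = 8"
    by (simp add: card_insert_if)
  then show "card U = 8" unfolding U_def card_unimodal_solutions[OF n] S .
  show "U = {(a *\<^sub>R e n, a *\<^sub>R e n), ((- a) *\<^sub>R e n, (- a) *\<^sub>R e n),
          (b *\<^sub>R e n, (- b) *\<^sub>R e n), ((- b) *\<^sub>R e n, b *\<^sub>R e n),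
          (p *\<^sub>R e n, (- q) *\<^sub>R e n), ((- p) *\<^sub>R e n, q *\<^sub>R e n),
          (q *\<^sub>R e n, (- p) *\<^sub>R e n), ((- q) *\<^sub>R e n, p *\<^sub>R e n)}"
    unfolding U_def unimodal_solutions_eq_image[OF n] S by simp
qed

lemma not_EE_trivial:
  assumes "n \<notin> EE lam \<beta>" "weak_solution lam e \<beta> \<rho> k (x *\<^sub>R e n, y *\<^sub>R e n)"
  shows "x = 0 \<and> y = 0"
proof (rule trivial_if_nonneg[OF coefficients_pos])
  show "0 \<le> lam n + \<beta>" using assms(1) by (simp add: EE_iffs)
qed (use assms(2) in \<open>simp_all only: weak_solution_e_iff[OF n]\<close>)

lemma not_EE_empty:
  assumes "n \<notin> EE lam \<beta>"
  shows "unimodal_solutions lam e \<beta> \<rho> k n = {}"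
  using not_EE_trivial[OF assms] unfolding unimodal_solutions_def by blast

end

section \<open>Counting over all modes\<close>

lemma EE_partition:
  assumes "0 < k"
  shows "EE lam \<beta> = EE1 lam \<beta> k \<union> EE2 lam \<beta> k \<union> EE3 lam \<beta> k"
    "EE1 lam \<beta> k \<inter> EE2 lam \<beta> k = {}" "EE1 lam \<beta> k \<inter> EE3 lam \<beta> k = {}" "EE2 lam \<beta> k \<inter> EE3 lam \<beta> k = {}"
proof -
  have "(n \<in> EE lam \<beta> \<longleftrightarrow> n \<in> EE1 lam \<beta> k \<or> n \<in> EE2 lam \<beta> k \<or> n \<in> EE3 lam \<beta> k) \<and>
      \<not> (n \<in> EE1 lam \<beta> k \<and> n \<in> EE2 lam \<beta> k) \<and> \<not> (n \<in> EE1 lam \<beta> k \<and> n \<in> EE3 lam \<beta> k) \<and>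
      \<not> (n \<in> EE2 lam \<beta> k \<and> n \<in> EE3 lam \<beta> k)" for n
  proof (cases "n \<ge> 1")
    case True
    \<comment> \<open>Strictly increasing thresholds make the three index sets correspond to
      consecutive disjoint ranges of \<open>- \<beta>\<close>.\<close>
    then have "lam n < mu lam k n" "mu lam k n < nu lam k n"
      using assms lam_pos[OF True] by (simp_all add: mu_def nu_def divide_strict_right_mono)
    then show ?thesis
      unfolding EE_def EE1_def EE2_def EE3_def mem_Collect_eq by auto
  qed (simp add: EE_def EE1_def EE2_def EE3_def)
  then show "EE lam \<beta> = EE1 lam \<beta> k \<union> EE2 lam \<beta> k \<union> EE3 lam \<beta> k"
    "EE1 lam \<beta> k \<inter> EE2 lam \<beta> k = {}" "EE1 lam \<beta> k \<inter> EE3 lam \<beta> k = {}" "EE2 lam \<beta> k \<inter> EE3 lam \<beta> k = {}"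
    by blast+
qed

lemma card_all_unimodal:
  fixes \<beta> \<rho> k :: real
  assumes \<rho>: "0 < \<rho>" and k: "0 < k"
  defines "W \<equiv> (\<Union>n\<in>{1..}. unimodal_solutions lam e \<beta> \<rho> k n)"
  shows "finite W"
    "card W = 2 * card (EE1 lam \<beta> k) + 4 * card (EE2 lam \<beta> k) + 8 * card (EE3 lam \<beta> k)"
proof -
  let ?U = "unimodal_solutions lam e \<beta> \<rho> k" and ?c = "\<lambda>n. card (unimodal_solutions lam e \<beta> \<rho> k n)"
  let ?E1 = "EE1 lam \<beta> k" and ?E2 = "EE2 lam \<beta> k" and ?E3 = "EE3 lam \<beta> k"
  note part = EE_partition[OF k, of \<beta>]
  have ge1: "n \<ge> 1" if "n \<in> EE lam \<beta>" for n using that by (simp add: EE_def)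
  have W: "W = (\<Union>n\<in>EE lam \<beta>. ?U n)"
    unfolding W_def using not_EE_empty[OF \<rho> k] ge1 by fastforce
  have c: "?c n = 2" if "n \<in> ?E1" for n
    using that part(1) ge1 unimodal_EE1(2)[OF \<rho> k] by blast
  have c': "?c n = 4" if "n \<in> ?E2" for n
    using that part(1) ge1 unimodal_EE2(3)[OF \<rho> k] by blast
  have c'': "?c n = 8" if "n \<in> ?E3" for n
    using that part(1) ge1 unimodal_EE3(6)[OF \<rho> k] by blast
  \<comment> \<open>Infinite sets have \<open>card\<close> equal to 0, so a nonzero count certifies
    that each mode has finitely many solutions.\<close>
  have "?c n \<noteq> 0" if "n \<in> EE lam \<beta>" for n
    using that c c' c'' unfolding part(1) by fastforce
  then have fin: "\<forall>n\<in>EE lam \<beta>. finite (?U n)"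
    by (meson card.infinite)
  then show "finite W" unfolding W using finite_EE by blast
  have finE: "finite ?E1" "finite ?E2" "finite ?E3"
    using finite_EE[of \<beta>] unfolding part(1) by simp_all
  have "card W = (\<Sum>n\<in>EE lam \<beta>. ?c n)"
    unfolding W using ge1 unimodal_solutions_disjoint
    by (intro card_UN_disjoint finite_EE fin) blast
  also have "\<dots> = (\<Sum>n\<in>?E1. ?c n) + (\<Sum>n\<in>?E2. ?c n) + (\<Sum>n\<in>?E3. ?c n)"
    unfolding part(1) using finE part(2-4)
    by (subst sum.union_disjoint; auto)+
  also have "\<dots> = 2 * card ?E1 + 4 * card ?E2 + 8 * card ?E3"
    using c c' c'' by simp
  finally show "card W = 2 * card ?E1 + 4 * card ?E2 + 8 * card ?E3" .
qed

lemma unimodal_nonempty_iff: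
  assumes \<rho>: "0 < \<rho>" and k: "0 < k"
  shows "(\<exists>n\<ge>1. unimodal_solutions lam e \<beta> \<rho> k n \<noteq> {}) \<longleftrightarrow> EE lam \<beta> \<noteq> {}"
proof
  assume "\<exists>n\<ge>1. unimodal_solutions lam e \<beta> \<rho> k n \<noteq> {}"
  then show "EE lam \<beta> \<noteq> {}" using not_EE_empty[OF \<rho> k] by blast
next
  assume "EE lam \<beta> \<noteq> {}"
  then obtain n where n: "n \<in> EE lam \<beta>" by blast
  then have "n \<ge> 1" by (simp add: EE_def)
  moreover have "unimodal_solutions lam e \<beta> \<rho> k n \<noteq> {}"
    using n unimodal_EE1(3)[OF \<rho> k \<open>n \<ge> 1\<close>] unimodal_EE2(4)[OF \<rho> k \<open>n \<ge> 1\<close>]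
      unimodal_EE3(7)[OF \<rho> k \<open>n \<ge> 1\<close>] unfolding EE_partition(1)[OF k] by blast
  ultimately show "\<exists>n\<ge>1. unimodal_solutions lam e \<beta> \<rho> k n \<noteq> {}" by blast
qed

end

theorem theorem4p2:
  fixes D :: "'h::{real_inner, polish_space} set" and A :: "'h \<Rightarrow> 'h"
    and lam :: "nat \<Rightarrow> real" and e :: "nat \<Rightarrow> 'h" and \<beta> \<rho> k :: real
  assumes "simple_spectrum_operator D A lam e" and "\<rho> > 0" and "k > 0"
  shows
    "((\<exists>n\<ge>1. unimodal_solutions lam e \<beta> \<rho> k n \<noteq> {}) \<longleftrightarrow> EE lam \<beta> \<noteq> {}) \<and>
     (EE lam \<beta> = EE1 lam \<beta> k \<union> EE2 lam \<beta> k \<union> EE3 lam \<beta> k \<and>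
      EE1 lam \<beta> k \<inter> EE2 lam \<beta> k = {} \<and>
      EE1 lam \<beta> k \<inter> EE3 lam \<beta> k = {} \<and>
      EE2 lam \<beta> k \<inter> EE3 lam \<beta> k = {}) \<and>
     (\<forall>n\<ge>1.
       (let a1 = alpha1 lam \<beta> \<rho> n; a2 = alpha2 lam \<beta> \<rho> k n;
            a3 = alpha3 lam \<beta> \<rho> k n; a4 = alpha4 lam \<beta> \<rho> k n;
            U = unimodal_solutions lam e \<beta> \<rho> k n
        in
         (n \<in> EE1 lam \<beta> k \<longrightarrow>
            0 \<le> rad1 lam \<beta> \<rho> n \<and>
            card U = 2 \<and>
            U = {(a1 *\<^sub>R e n, a1 *\<^sub>R e n), ((- a1) *\<^sub>R e n, (- a1) *\<^sub>R e n)}) \<and>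
         (n \<in> EE2 lam \<beta> k \<longrightarrow>
            0 \<le> rad1 lam \<beta> \<rho> n \<and> 0 \<le> rad2 lam \<beta> \<rho> k n \<and>
            card U = 4 \<and>
            U = {(a1 *\<^sub>R e n, a1 *\<^sub>R e n), ((- a1) *\<^sub>R e n, (- a1) *\<^sub>R e n),
                 (a2 *\<^sub>R e n, (- a2) *\<^sub>R e n), ((- a2) *\<^sub>R e n, a2 *\<^sub>R e n)}) \<and>
         (n \<in> EE3 lam \<beta> k \<longrightarrow>
            0 \<le> rad1 lam \<beta> \<rho> n \<and> 0 \<le> rad2 lam \<beta> \<rho> k n \<and>
            0 \<le> disc lam \<beta> k n \<and> 0 \<le> rad3 lam \<beta> \<rho> k n \<and> 0 \<le> rad4 lam \<beta> \<rho> k n \<and>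
            card U = 8 \<and>
            U = {(a1 *\<^sub>R e n, a1 *\<^sub>R e n), ((- a1) *\<^sub>R e n, (- a1) *\<^sub>R e n),
                 (a2 *\<^sub>R e n, (- a2) *\<^sub>R e n), ((- a2) *\<^sub>R e n, a2 *\<^sub>R e n),
                 (a3 *\<^sub>R e n, (- a4) *\<^sub>R e n), ((- a3) *\<^sub>R e n, a4 *\<^sub>R e n),
                 (a4 *\<^sub>R e n, (- a3) *\<^sub>R e n), ((- a4) *\<^sub>R e n, a3 *\<^sub>R e n)}) \<and>
         (n \<notin> EE lam \<beta> \<longrightarrow>
            (\<forall>\<alpha> \<gamma>. weak_solution lam e \<beta> \<rho> k (\<alpha> *\<^sub>R e n, \<gamma> *\<^sub>R e n) \<longrightarrow>
                    \<alpha> *\<^sub>R e n = 0 \<and> \<gamma> *\<^sub>R e n = 0)))) \<and>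
     (finite (EE lam \<beta>) \<and>
      finite (\<Union>n\<in>{1..}. unimodal_solutions lam e \<beta> \<rho> k n) \<and>
      card (\<Union>n\<in>{1..}. unimodal_solutions lam e \<beta> \<rho> k n) =
        2 * card (EE1 lam \<beta> k) + 4 * card (EE2 lam \<beta> k) + 8 * card (EE3 lam \<beta> k))"
proof -
  interpret simple_spectrum_operator D A lam e by fact
  note \<rho> = assms(2) and k = assms(3)
  show ?thesis
    unfolding Let_def
  proof (intro conjI allI impI)
    \<comment> \<open>Only modes outside \<open>EE\<close> need an argument here, from vanishing
      coefficients to vanishing vectors; the other goals are clauses of the preceding
      lemmas.\<close>
    fix n :: nat assume n: "1 \<le> n"
    fix \<alpha> \<gamma> assume "n \<notin> EE lam \<beta>" "weak_solution lam e \<beta> \<rho> k (\<alpha> *\<^sub>R e n, \<gamma> *\<^sub>R e n)"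
    from not_EE_trivial[OF \<rho> k n this] show "\<alpha> *\<^sub>R e n = 0" "\<gamma> *\<^sub>R e n = 0" by simp_all
  qed (rule unimodal_nonempty_iff[OF \<rho> k] EE_partition[OF k] finite_EE card_all_unimodal[OF \<rho> k]
      unimodal_EE1[OF \<rho> k] unimodal_EE2[OF \<rho> k] unimodal_EE3[OF \<rho> k]; assumption)+
qed

end
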